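(* Let $h>0$, $b,\mu\in\mathbb{R}$ and $\nu\ge 0$, and suppose that $-\frac{\mu}{h}$ and $-\frac{\mu}{h}+\nu$ both belong to $\mathbb{R}\setminus\{\ldots,-2,-1\}$. Let $g$ be the function $g(s)=(b-\mu-s)_h^{(-\frac{\mu}{h})}$ for $s\in\{b,b-h,b-2h,\ldots\}$. Then $$\left({_h}\Delta_{b}^{-\nu} g\right)(t) =\frac{\Gamma(-\frac{\mu}{h}+1)}{\Gamma(-\frac{\mu}{h}+\nu+1)}\,(b-\mu-t)_h^{(-\frac{\mu}{h}+\nu)}$$ for all $t\in\{b-\nu h,\, b-\nu h-h,\, b-\nu h-2h,\ldots\}$.
   Context: For $h>0$ and $x,y\in\mathbb{R}$ the $h$-factorial function is $x_h^{(y)} = h^y\,\dfrac{\Gamma(\frac{x}{h}+1)}{\Gamma(\frac{x}{h}+1-y)}$, where $\Gamma$ is the Euler gamma function, with the convention that division at a pole yields zero. Put $\sigma_h(t)=t+h$. For a real-valued function $f$ on $\{b,b-h,b-2h,\ldots\}$ the right fractional $h$-sum of order $\nu>0$ is $$\left({_h}\Delta_b^{-\nu}f\right)(t)=\frac{1}{\Gamma(\nu)}\sum_{k=\frac{t}{h}+\nu}^{\frac{b}{h}}(kh-\sigma_h(t))_h^{(\nu-1)}f(kh)\,h, \quad t\in\{b-\nu h,b-\nu h-h,\ldots\},$$ where $k$ runs in unit steps over $\frac{t}{h}+\nu,\frac{t}{h}+\nu+1,\ldots,\frac{b}{h}$ (not necessarily integers). For $\nu=0$, $\left({_h}\Delta_b^{0}f\right)(t)=f(t)$.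 *)

theory Defs
  imports "HOL-Analysis.Gamma_Function"
begin

text \<open>Gamma is 0 at its poles and division by 0 is 0 in HOL, so the convention that division
  at a pole yields zero holds by itself.\<close>

definition h_factorial :: "real \<Rightarrow> real \<Rightarrow> real \<Rightarrow> real"
  where "h_factorial h x y = h powr y * (Gamma (x / h + 1) / Gamma (x / h + 1 - y))"

definition forward_jump :: "real \<Rightarrow> real \<Rightarrow> real"
  where "forward_jump h t = t + h"

definition down_grid :: "real \<Rightarrow> real \<Rightarrow> real set"
  where "down_grid h b = {b - real n * h | n :: nat. True}"

definition unit_steps :: "real \<Rightarrow> real \<Rightarrow> real set"
  where "unit_steps a c = {a + real n | n :: nat. a + real n \<le> c}"

text \<open>Meaningful for \<open>h > 0\<close>, \<open>\<nu> \<ge> 0\<close> and \<open>t \<in> down_grid h (b - \<nu> * h)\<close>; on such arguments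
  only the values of \<open>f\<close> on \<open>down_grid h b\<close> are used. The summation index is real-valued.\<close>

definition right_frac_sum :: "real \<Rightarrow> real \<Rightarrow> real \<Rightarrow> (real \<Rightarrow> real) \<Rightarrow> real \<Rightarrow> real"
  where "right_frac_sum h b \<nu> f t =
    (if \<nu> = 0 then f t
     else 1 / Gamma \<nu> *
       (\<Sum>k\<in>unit_steps (t / h + \<nu>) (b / h).
          h_factorial h (k * h - forward_jump h t) (\<nu> - 1) * f (k * h) * h))"

end

theory Submission imports Defs begin

text \<open>Put \<open>a = - \<mu> / h\<close> and \<open>t = b - \<nu> h - n h\<close>. Up to powers of \<open>h\<close>, the \<open>j\<close>-th summand is
  \<open>\<Gamma>(\<nu> + j) / j! * \<Gamma>(a + 1 + (n - j)) / (n - j)!\<close>; writing these Gamma quotients as rising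
  factorials of \<open>\<nu>\<close> and \<open>a + 1\<close>, the claim becomes the Chu-Vandermonde identity.\<close>

text \<open>This is the binomial theorem for rising factorials divided by \<open>fact n\<close>: the
  binomial coefficient splits into the two factorial denominators.\<close>

lemma pochhammer_Vandermonde:
  fixes x y :: "'a :: field_char_0"
  shows "(\<Sum>j\<le>n. pochhammer x j / fact j * (pochhammer y (n - j) / fact (n - j))) =
    pochhammer (x + y) n / fact n"
proof -
  have "of_nat (n choose j) * pochhammer x j * pochhammer y (n - j) / fact n =
      pochhammer x j / fact j * (pochhammer y (n - j) / fact (n - j))" if "j \<le> n" for j
    using that by (simp add: binomial_fact divide_simps)
  then show ?thesis
    by (simp add: pochhammer_binomial_sum sum_divide_distrib)
qed

lemma h_factorial_mult:
  assumes "h > 0"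
  shows "h_factorial h (h * x) y = h powr y * (Gamma (x + 1) / Gamma (x + 1 - y))"
  using assms by (simp add: h_factorial_def)

text \<open>At this argument the denominator is Gamma at \<open>n + 1\<close>, a factorial, and the
  functional equation turns the numerator into a rising factorial. It serves for the orders
  \<open>\<nu> - 1\<close>, \<open>a\<close> and \<open>a + \<nu>\<close>.\<close>

lemma h_factorial_add_nat:
  assumes "h > 0" and "y + 1 \<notin> \<int>\<^sub>\<le>\<^sub>0"
  shows "h_factorial h (h * (y + real n)) y =
    h powr y * Gamma (y + 1) * (pochhammer (y + 1) n / fact n)"
proof -
  have "Gamma (y + real n + 1) = Gamma (y + 1) * pochhammer (y + 1) n"
    using assms(2) pochhammer_Gamma[of "y + 1" n]
    by (simp add: Gamma_eq_zero_iff add_ac)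
  moreover have "Gamma (real n + 1) = fact n"
    by (metis Gamma_fact add.commute)
  ultimately show ?thesis
    using assms(1) by (simp add: h_factorial_mult)
qed

text \<open>Counting from the lower end puts \<open>n - j\<close> into the summand, the form a
  convolution needs.\<close>

lemma sum_unit_steps:
  "(\<Sum>k\<in>unit_steps (c - real n) c. f k) = (\<Sum>j\<le>n. f (c - real (n - j)))"
proof -
  have "unit_steps (c - real n) c = (\<lambda>j. c - real (n - j)) ` {..n}"
    by (force simp: unit_steps_def of_nat_diff image_iff)
  moreover have "inj_on (\<lambda>j. c - real (n - j)) {..n}"
    by (auto simp: inj_on_def)
  ultimately show ?thesis
    by (simp only: sum.reindex o_def)
qed

text \<open>Translates the hypotheses of the theorem into the absence of Gamma poles.\<close>

lemma add_1_notin_nonpos_Ints: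
  fixes x :: real
  assumes "x \<notin> {- real n | n :: nat. n \<ge> 1}"
  shows "x + 1 \<notin> \<int>\<^sub>\<le>\<^sub>0"
proof
  assume "x + 1 \<in> \<int>\<^sub>\<le>\<^sub>0"
  then obtain n where "x + 1 = - real n"
    by (auto elim: nonpos_Ints_cases')
  then have "x = - real (Suc n)"
    by simp
  with assms show False
    by (metis (mono_tags, lifting) le_add1 mem_Collect_eq plus_1_eq_Suc)
qed

lemma right_frac_sum_h_factorial:
  fixes h a b \<nu> :: real
  assumes "h > 0" "\<nu> > 0" "a + 1 \<notin> \<int>\<^sub>\<le>\<^sub>0" "a + \<nu> + 1 \<notin> \<int>\<^sub>\<le>\<^sub>0"
    and g: "\<And>m. g (b - real m * h) = h_factorial h (h * (a + real m)) a"
  shows "right_frac_sum h b \<nu> g (b - \<nu> * h - real n * h) =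
    Gamma (a + 1) / Gamma (a + \<nu> + 1) * h_factorial h (h * (a + \<nu> + real n)) (a + \<nu>)"
proof -
  define t where "t = b - \<nu> * h - real n * h"
  have t: "t / h + \<nu> = b / h - real n"
    using \<open>h > 0\<close> by (simp add: t_def field_simps)
  have \<nu>: "\<nu> \<notin> \<int>\<^sub>\<le>\<^sub>0"
    using \<open>\<nu> > 0\<close> by (auto elim: nonpos_Ints_cases')
  \<comment> \<open>The three powers of \<open>h\<close> come from the kernel, from \<open>g\<close>
    and from the step width; their product is the same in every summand.\<close>
  have powr: "h powr (\<nu> - 1) * h powr a * h = h powr (a + \<nu>)"
    using \<open>h > 0\<close> by (simp add: powr_add powr_diff)
  have summand: "h_factorial h ((b / h - real (n - j)) * h - forward_jump h t) (\<nu> - 1) *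
        g ((b / h - real (n - j)) * h) * h =
      h powr (a + \<nu>) * Gamma \<nu> * Gamma (a + 1) *
        (pochhammer \<nu> j / fact j * (pochhammer (a + 1) (n - j) / fact (n - j)))"
    if "j \<le> n" for j
  proof -
    have "(b / h - real (n - j)) * h = b - real (n - j) * h"
      using \<open>h > 0\<close> by (simp add: field_simps)
    \<comment> \<open>The jump by \<open>h\<close> lowers \<open>\<nu>\<close> to
      \<open>\<nu> - 1\<close>, the order of the kernel, so \<open>h_factorial_add_nat\<close>
      applies with offset \<open>j\<close>; for \<open>g\<close> it applies with offset
      \<open>n - j\<close>.\<close>
    moreover have "b - real (n - j) * h - forward_jump h t = h * (\<nu> - 1 + real j)"
      using that by (simp add: t_def forward_jump_def of_nat_diff algebra_simps)
    ultimately show ?thesis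
      using assms(1,3) \<nu> h_factorial_add_nat[of h "\<nu> - 1" j]
      by (simp add: g h_factorial_add_nat powr[symmetric])
  qed
  have "right_frac_sum h b \<nu> g t = h powr (a + \<nu>) * Gamma (a + 1) *
      (\<Sum>j\<le>n. pochhammer \<nu> j / fact j * (pochhammer (a + 1) (n - j) / fact (n - j)))"
  proof -
    have "right_frac_sum h b \<nu> g t = 1 / Gamma \<nu> * (\<Sum>j\<le>n. h powr (a + \<nu>) * Gamma \<nu> *
        Gamma (a + 1) * (pochhammer \<nu> j / fact j * (pochhammer (a + 1) (n - j) / fact (n - j))))"
      using \<open>\<nu> > 0\<close> by (simp add: right_frac_sum_def t sum_unit_steps summand del: of_nat_diff)
    \<comment> \<open>As \<open>\<nu>\<close> is not a pole, Gamma at \<open>\<nu>\<close> is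
      nonzero and cancels the prefactor of the fractional sum.\<close>
    then show ?thesis
      using \<nu> unfolding sum_distrib_left[symmetric] by (simp add: Gamma_eq_zero_iff)
  qed
  also have "\<dots> = h powr (a + \<nu>) * Gamma (a + 1) * (pochhammer (a + \<nu> + 1) n / fact n)"
    by (simp only: pochhammer_Vandermonde add_ac)
  \<comment> \<open>\<open>h_factorial_add_nat\<close> at order \<open>a + \<nu>\<close> brings in
    Gamma at \<open>a + \<nu> + 1\<close>, which the quotient cancels.\<close>
  also have "\<dots> = Gamma (a + 1) / Gamma (a + \<nu> + 1) *
      h_factorial h (h * (a + \<nu> + real n)) (a + \<nu>)"
    using assms(1,4) by (simp add: h_factorial_add_nat Gamma_eq_zero_iff)
  finally show ?thesis
    by (simp add: t_def)
qed

theorem corollary11: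
  fixes h b \<mu> \<nu> :: real and g :: "real \<Rightarrow> real"
  assumes "h > 0" and "\<nu> \<ge> 0"
    and "- (\<mu> / h) \<notin> {- real n | n :: nat. n \<ge> 1}"
    and "- (\<mu> / h) + \<nu> \<notin> {- real n | n :: nat. n \<ge> 1}"
    and "\<And>s. s \<in> down_grid h b \<Longrightarrow> g s = h_factorial h (b - \<mu> - s) (- (\<mu> / h))"
  shows "\<forall>t \<in> down_grid h (b - \<nu> * h).
    right_frac_sum h b \<nu> g t =
      Gamma (- (\<mu> / h) + 1) / Gamma (- (\<mu> / h) + \<nu> + 1) *
        h_factorial h (b - \<mu> - t) (- (\<mu> / h) + \<nu>)"
proof
  fix t assume t: "t \<in> down_grid h (b - \<nu> * h)"
  note notin = add_1_notin_nonpos_Ints[OF assms(3)] add_1_notin_nonpos_Ints[OF assms(4)]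
  show "right_frac_sum h b \<nu> g t =
      Gamma (- (\<mu> / h) + 1) / Gamma (- (\<mu> / h) + \<nu> + 1) *
        h_factorial h (b - \<mu> - t) (- (\<mu> / h) + \<nu>)"
  proof (cases "\<nu> = 0")
    \<comment> \<open>The sum of order 0 is \<open>g\<close> itself, and the Gamma quotient is 1
      because its argument is not a pole; at a pole it would be 0.\<close>
    case True
    then show ?thesis
      using t notin(1) assms(5) by (simp add: right_frac_sum_def Gamma_eq_zero_iff)
  next
    case False
    from t obtain n where n: "t = b - \<nu> * h - real n * h"
      by (auto simp: down_grid_def)
    have g: "g (b - real m * h) = h_factorial h (h * (- (\<mu> / h) + real m)) (- (\<mu> / h))" for m
    proof -
      have "b - \<mu> - (b - real m * h) = h * (- (\<mu> / h) + real m)"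
        using \<open>h > 0\<close> by (simp add: field_simps)
      moreover have "b - real m * h \<in> down_grid h b"
        by (auto simp: down_grid_def)
      ultimately show ?thesis
        using assms(5) by metis
    qed
    have "b - \<mu> - t = h * (- (\<mu> / h) + \<nu> + real n)"
      using \<open>h > 0\<close> by (simp add: n field_simps)
    then show ?thesis
      using right_frac_sum_h_factorial[OF assms(1) _ notin g] False assms(2) n by simp
  qed
qed

end
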